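(* Let $\epsilon>0$ be given. The probability measure $\pi_\epsilon$ defined by $$\pi_\epsilon[B]:=\frac{\int_Bw_\epsilon(\theta)\,\pi(d\theta)}{\int_\Theta w_\epsilon(\theta')\,\pi(d\theta')},\qquad B\in\mathcal B(\Theta),$$ is the unique minimizer on $\mathscr P(\Theta)$ of the functional $$\mathcal F_\epsilon(\rho):=\begin{cases}-\displaystyle\int_\Theta\log w_\epsilon(\theta)\,\rho(d\theta)+\mathrm{KL}(\rho\mid\pi),&\text{if }\rho\ll\pi,\\[1ex]\infty,&\text{otherwise,}\end{cases}$$ with minimum value $$\min_{\rho\in\mathscr P(\Theta)}\mathcal F_\epsilon(\rho)=\mathcal F_\epsilon(\pi_\epsilon)=-\log\int_\Theta w_\epsilon(\theta)\,\pi(d\theta).$$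
   Context: $\Theta\subseteq\mathbb R^{m_\Theta}$ is endowed with the topology induced by a metric $d_\Theta$; $\mathcal B(\Theta)$ is its Borel $\sigma$-algebra and $\mathscr P(\Theta)$ the set of probability measures on $\mathcal B(\Theta)$; $\mathbb R_+=[0,\infty)$. $\pi\in\mathscr P(\Theta)$ is a fixed prior. $w_\epsilon:\Theta\to\mathbb R_+$ is a Borel measurable function (compatibility weight) with $0<w_\epsilon\le1$ $\pi$-a.s. (up to modification on a $\pi$-null set, everywhere on $\Theta$). $\mathrm{KL}(\rho\mid\pi):=\int_\Theta\log\frac{d\rho}{d\pi}(\theta)\,\rho(d\theta)$ if $\rho\ll\pi$, and $\mathrm{KL}(\rho\mid\pi):=\infty$ otherwise. *)

theory Defs
  imports "HOL-Probability.Probability"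
begin

definition metric_borel :: "'a set \<Rightarrow> ('a \<Rightarrow> 'a \<Rightarrow> real) \<Rightarrow> 'a measure" where
  "metric_borel \<Theta> d = sigma \<Theta> {U. openin (Metric_space.mtopology \<Theta> d) U}"

definition prob_measures :: "'a measure \<Rightarrow> 'a measure set" where
  "prob_measures S = {\<rho>. prob_space \<rho> \<and> sets \<rho> = sets S}"

text \<open>
  The Bochner integral returns 0 on non-integrable functions, so it cannot express integrals with
  value \<open>\<plusminus>\<infinity>\<close>. The following is the usual extended integral, positive part minus negative part.
  It is only meaningful if one of the two parts is finite. This is the case below: when
  \<open>\<rho>\<close> is absolutely continuous with respect to \<open>\<pi>\<close>, the positive part of \<open>ln w\<close> vanishes
  \<open>\<rho>\<close>-a.e. (as \<open>w \<le> 1\<close> \<open>\<pi>\<close>-a.e.) and the negative part of \<open>ln (d\<rho>/d\<pi>)\<close> has \<open>\<rho>\<close>-integral at most 1.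
\<close>
definition ext_integral :: "'a measure \<Rightarrow> ('a \<Rightarrow> real) \<Rightarrow> ereal" where
  "ext_integral M f =
     enn2ereal (\<integral>\<^sup>+ x. ennreal (f x) \<partial>M) - enn2ereal (\<integral>\<^sup>+ x. ennreal (- f x) \<partial>M)"

text \<open>
  The library's \<^const>\<open>KL_divergence\<close> is real-valued (it is 0 when the log-density is not
  integrable), hence this extended-real version. The convention \<open>ln 0 = 0\<close> and the truncation of
  an infinite derivative only concern \<open>\<rho>\<close>-null sets. Note the argument order:
  \<open>absolutely_continuous \<pi> \<rho>\<close> means \<open>\<rho> \<ll> \<pi>\<close>, and \<open>RN_deriv \<pi> \<rho>\<close> is \<open>d\<rho>/d\<pi>\<close>.
\<close>
definition KL :: "'a measure \<Rightarrow> 'a measure \<Rightarrow> ereal" where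
  "KL \<rho> \<pi> =
     (if absolutely_continuous \<pi> \<rho>
      then ext_integral \<rho> (\<lambda>\<theta>. ln (enn2real (RN_deriv \<pi> \<rho> \<theta>)))
      else \<infinity>)"

text \<open>Points with \<open>w \<theta> = 0\<close> form a \<open>\<pi>\<close>-null set, so \<open>ln 0 = 0\<close> is again immaterial.\<close>
definition free_energy :: "'a measure \<Rightarrow> ('a \<Rightarrow> real) \<Rightarrow> 'a measure \<Rightarrow> ereal" where
  "free_energy \<pi> w \<rho> =
     (if absolutely_continuous \<pi> \<rho>
      then - ext_integral \<rho> (\<lambda>\<theta>. ln (w \<theta>)) + KL \<rho> \<pi>
      else \<infinity>)"

text \<open>
  \<^const>\<open>measure_of\<close> would yield the zero measure if the given set function were not a measure;
  the theorem therefore also asserts the formula for its values.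
\<close>
definition weighted_posterior :: "'a measure \<Rightarrow> ('a \<Rightarrow> real) \<Rightarrow> 'a measure" where
  "weighted_posterior \<pi> w =
     measure_of (space \<pi>) (sets \<pi>)
       (\<lambda>B. ennreal ((LINT \<theta>:B|\<pi>. w \<theta>) / (LINT \<theta>|\<pi>. w \<theta>)))"

end

theory Submission
  imports Defs
begin

text \<open>
  Write \<open>Z = \<integral> w d\<pi>\<close> and \<open>\<pi>\<^sub>w = w \<cdot> \<pi> / Z\<close>. Since \<open>w > 0\<close> almost surely, \<open>\<rho> \<ll> \<pi>\<close> with density \<open>f\<close> means
  \<open>\<rho> \<ll> \<pi>\<^sub>w\<close> with density \<open>f Z / w\<close>, so that the free energy of \<open>\<rho>\<close> is \<open>KL(\<rho> | \<pi>\<^sub>w) - ln Z\<close> whenever it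
  is finite, and Gibbs' inequality with its equality case applies. As the negative part of \<open>ln f\<close> is
  \<open>\<rho>\<close>-integrable and \<open>ln w \<le> 0\<close>, finiteness of the free energy amounts to integrability of both
  \<open>ln w\<close> and \<open>ln f\<close>.
\<close>

section \<open>Finite and infinite values of the extended integral\<close>

lemma ext_integral_integrable:
  assumes "integrable M f"
  shows "ext_integral M f = ereal (LINT x|M. f x)"
proof -
  have fin: "(\<integral>\<^sup>+ x. ennreal (f x) \<partial>M) \<noteq> \<infinity>" "(\<integral>\<^sup>+ x. ennreal (- f x) \<partial>M) \<noteq> \<infinity>"
    using assms by (auto simp: real_integrable_def)
  obtain p q where "0 \<le> p" "(\<integral>\<^sup>+ x. ennreal (f x) \<partial>M) = ennreal p"
    and "0 \<le> q" "(\<integral>\<^sup>+ x. ennreal (- f x) \<partial>M) = ennreal q"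
    using fin by (metis ennreal_cases infinity_ennreal_def)
  then show ?thesis
    by (simp add: ext_integral_def real_lebesgue_integral_def[OF assms] enn2ereal_ennreal)
qed

lemma ext_integral_eq_PInf:
  assumes "f \<in> borel_measurable M" "\<not> integrable M f" "(\<integral>\<^sup>+ x. ennreal (- f x) \<partial>M) \<noteq> \<infinity>"
  shows "ext_integral M f = \<infinity>"
proof -
  have "(\<integral>\<^sup>+ x. ennreal (f x) \<partial>M) = \<infinity>"
    using assms by (auto simp: real_integrable_def)
  moreover obtain q where "0 \<le> q" "(\<integral>\<^sup>+ x. ennreal (- f x) \<partial>M) = ennreal q"
    using assms(3) by (metis ennreal_cases infinity_ennreal_def)
  ultimately show ?thesis
    by (simp add: ext_integral_def enn2ereal_ennreal)
qed

lemma ext_integral_eq_MInf: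
  assumes "f \<in> borel_measurable M" "\<not> integrable M f" "(\<integral>\<^sup>+ x. ennreal (f x) \<partial>M) \<noteq> \<infinity>"
  shows "ext_integral M f = - \<infinity>"
proof -
  have "(\<integral>\<^sup>+ x. ennreal (- f x) \<partial>M) = \<infinity>"
    using assms by (auto simp: real_integrable_def)
  moreover obtain q where "0 \<le> q" "(\<integral>\<^sup>+ x. ennreal (f x) \<partial>M) = ennreal q"
    using assms(3) by (metis ennreal_cases infinity_ennreal_def)
  ultimately show ?thesis
    by (simp add: ext_integral_def enn2ereal_ennreal)
qed

text \<open>This is \<open>ln y <= y - 1\<close> at \<open>y = 1 / x\<close>, multiplied by
  \<open>x\<close>. It controls the negative part of the entropy integrand \<open>f ln f\<close> and
  later the integrability of \<open>w ln w\<close>.\<close>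

lemma neg_mult_ln_le_one:
  assumes "0 \<le> (x::real)"
  shows "- (x * ln x) \<le> 1"
proof (cases "x = 0")
  case False
  then have "0 < x" using assms by simp
  have "- ln x \<le> 1 / x - 1"
    using ln_le_minus_one[of "1 / x"] \<open>0 < x\<close> by (simp add: ln_div)
  then have "x * (- ln x) \<le> x * (1 / x - 1)"
    using \<open>0 < x\<close> by (intro mult_left_mono) auto
  then show ?thesis using \<open>0 < x\<close> by (simp add: right_diff_distrib)
qed simp

section \<open>The normalizing constant and the posterior\<close>

locale weighted_prior = prob_space M for M :: "'a measure" +
  fixes w :: "'a \<Rightarrow> real"
  assumes w_measurable [measurable]: "w \<in> borel_measurable M"
    and AE_w: "AE x in M. 0 < w x \<and> w x \<le> 1"
begin

abbreviation Z :: real where "Z \<equiv> LINT x|M. w x"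

lemma integrable_w: "integrable M w"
  by (rule integrable_const_bound[of _ 1]) (use AE_w in \<open>auto elim: AE_mp\<close>)

text \<open>If \<open>Z\<close> were zero, the a.e. nonnegative \<open>w\<close> would vanish almost
  everywhere, against its a.e. positivity on a space of mass one.\<close>

lemma Z_pos: "0 < Z"
proof -
  have nn: "AE x in M. 0 \<le> w x" using AE_w by (auto elim: AE_mp)
  have "Z \<noteq> 0"
  proof
    assume "Z = 0"
    then have "AE x in M. w x = 0"
      using integral_nonneg_eq_0_iff_AE[OF integrable_w nn] by simp
    with AE_w have "AE x in M. False" by eventually_elim auto
    then show False using AE_False by simp
  qed
  with integral_nonneg_AE[OF nn] show ?thesis by simp
qed

text \<open>Given as a density, so that change of measure and the library's results on divergence
  apply; \<open>weighted_posterior_eq\<close> links it to the set function of the theorem.\<close>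

definition posterior :: "'a measure" where
  "posterior = density M (\<lambda>x. ennreal (w x / Z))"

lemma sets_posterior [measurable_cong, simp]: "sets posterior = sets M"
  and space_posterior [simp]: "space posterior = space M"
  by (simp_all add: posterior_def)

lemma AE_w_div_Z: "AE x in M. 0 < w x / Z"
  using AE_w Z_pos by (auto elim: AE_mp)

lemma emeasure_posterior:
  assumes [measurable]: "B \<in> sets M"
  shows "emeasure posterior B = ennreal ((LINT x:B|M. w x) / Z)"
proof -
  have "emeasure posterior B = (\<integral>\<^sup>+ x. ennreal (indicator B x * w x / Z) \<partial>M)"
    unfolding posterior_def
    by (subst emeasure_density) (auto intro!: nn_integral_cong simp: indicator_def)
  also have "\<dots> = ennreal (LINT x|M. indicator B x * w x / Z)"
  proof (rule nn_integral_eq_integral)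
    show "integrable M (\<lambda>x. indicator B x * w x / Z)"
      using integrable_mult_indicator[OF assms integrable_w] by simp
    show "AE x in M. 0 \<le> indicator B x * w x / Z"
      using AE_w_div_Z by eventually_elim (auto simp: indicator_def)
  qed
  finally show ?thesis by (simp add: set_lebesgue_integral_def)
qed

lemma prob_space_posterior: "prob_space posterior"
proof
  have "(LINT x:space M|M. w x) = Z"
    unfolding set_lebesgue_integral_def by (rule Bochner_Integration.integral_cong) auto
  then show "emeasure posterior (space posterior) = 1"
    using Z_pos by (simp add: emeasure_posterior)
qed

text \<open>On measurable sets the defining set function agrees with the measure of
  \<open>posterior\<close>, so \<open>measure_of\<close> does not fall back to the zero
  measure.\<close>

lemma weighted_posterior_eq: "weighted_posterior M w = posterior"
proof -
  have "weighted_posterior M w = measure_of (space M) (sets M) (emeasure posterior)"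
    unfolding weighted_posterior_def
    by (rule measure_of_eq) (auto simp: sets.space_closed sets.sigma_sets_eq emeasure_posterior)
  also have "\<dots> = posterior"
    using measure_of_of_measure[of posterior] by simp
  finally show ?thesis .
qed

lemma measure_posterior:
  assumes "B \<in> sets M"
  shows "measure posterior B = (LINT x:B|M. w x) / Z"
proof -
  have "0 \<le> (LINT x:B|M. w x)"
    unfolding set_lebesgue_integral_def
    by (rule integral_nonneg_AE) (use AE_w in \<open>auto simp: indicator_def elim: AE_mp\<close>)
  then show ?thesis
    using Z_pos by (simp add: measure_def emeasure_posterior[OF assms])
qed

lemma absolutely_continuous_posterior: "absolutely_continuous M posterior"
  unfolding posterior_def by (rule absolutely_continuousI_density) simp

end

section \<open>Measures absolutely continuous with respect to the prior\<close>

locale weighted_prior_ac = weighted_prior +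
  fixes N :: "'a measure"
  assumes prob_N: "prob_space N" and sets_N [measurable_cong, simp]: "sets N = sets M"
    and ac: "absolutely_continuous M N"
begin

definition f :: "'a \<Rightarrow> real" where "f x = enn2real (RN_deriv M N x)"

lemma f_measurable [measurable]: "f \<in> borel_measurable M"
  unfolding f_def by simp

lemma f_nonneg: "0 \<le> f x"
  by (simp add: f_def)

text \<open>\<open>N\<close> is sigma-finite, so its Radon-Nikodym derivative is finite
  \<open>M\<close>-a.e. and \<open>enn2real\<close> alters it only on a null set.\<close>

lemma N_eq: "N = density M (\<lambda>x. ennreal (f x))"
proof -
  interpret N: prob_space N by (rule prob_N)
  have "AE x in M. RN_deriv M N x \<noteq> \<infinity>"
    by (rule RN_deriv_finite) (auto simp: ac N.sigma_finite_measure_axioms)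
  then have "AE x in M. RN_deriv M N x = ennreal (f x)"
    by eventually_elim (auto simp: f_def less_top)
  then have "density M (RN_deriv M N) = density M (\<lambda>x. ennreal (f x))"
    by (intro density_cong) auto
  then show ?thesis using density_RN_deriv[OF ac sets_N] by simp
qed

text \<open>The zero set of the density \<open>f\<close> is \<open>N\<close>-null, and the bounds on
  \<open>w\<close> pass from \<open>M\<close> to \<open>N\<close> by absolute continuity. This makes
  the laws of \<open>ln\<close> usable \<open>N\<close>-a.e.\<close>

lemma AE_N: "AE x in N. 0 < f x \<and> 0 < w x \<and> w x \<le> 1"
proof -
  have "AE x in N. 0 < w x \<and> w x \<le> 1"
    by (rule absolutely_continuous_AE[OF sets_N ac AE_w])
  moreover have "AE x in N. 0 < f x"
    by (subst N_eq, subst AE_density) auto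
  ultimately show ?thesis by eventually_elim auto
qed

lemma nn_integral_ln_w: "(\<integral>\<^sup>+ x. ennreal (ln (w x)) \<partial>N) = 0"
proof -
  have "(\<integral>\<^sup>+ x. ennreal (ln (w x)) \<partial>N) = (\<integral>\<^sup>+ x. 0 \<partial>N)"
    by (rule nn_integral_cong_AE) (use AE_N in \<open>eventually_elim, auto simp: ennreal_neg\<close>)
  then show ?thesis by simp
qed

text \<open>Passing to \<open>M\<close> turns the integrand into the positive part of
  \<open>- (f ln f)\<close>, which is at most 1, and \<open>M\<close> has mass one.\<close>

lemma nn_integral_neg_ln_f: "(\<integral>\<^sup>+ x. ennreal (- ln (f x)) \<partial>N) \<le> 1"
proof -
  have "(\<integral>\<^sup>+ x. ennreal (- ln (f x)) \<partial>N) = (\<integral>\<^sup>+ x. ennreal (f x) * ennreal (- ln (f x)) \<partial>M)"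
    by (subst N_eq, subst nn_integral_density) auto
  also have "\<dots> \<le> (\<integral>\<^sup>+ x. 1 \<partial>M)"
    using neg_mult_ln_le_one[OF f_nonneg]
    by (intro nn_integral_mono) (auto simp: ennreal_mult'[symmetric] f_nonneg)
  finally show ?thesis by (simp add: emeasure_space_1)
qed

text \<open>Neither summand can be minus infinity, so opposite infinities never meet: a failure of
  integrability in either one makes the sum infinite.\<close>

lemma free_energy_eq:
  "free_energy M w N =
    (if integrable N (\<lambda>x. ln (w x)) \<and> integrable N (\<lambda>x. ln (f x))
     then ereal (LINT x|N. ln (f x) - ln (w x)) else \<infinity>)"
proof -
  have F: "free_energy M w N = - ext_integral N (\<lambda>x. ln (w x)) + ext_integral N (\<lambda>x. ln (f x))"
    by (simp add: free_energy_def KL_def ac f_def)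
  have fin: "(\<integral>\<^sup>+ x. ennreal (- ln (f x)) \<partial>N) \<noteq> \<infinity>"
    using nn_integral_neg_ln_f by (auto simp: top_unique)
  have w: "ext_integral N (\<lambda>x. ln (w x)) = - \<infinity>" if "\<not> integrable N (\<lambda>x. ln (w x))"
    by (rule ext_integral_eq_MInf) (use that nn_integral_ln_w in auto)
  have f: "ext_integral N (\<lambda>x. ln (f x)) = \<infinity>" if "\<not> integrable N (\<lambda>x. ln (f x))"
    by (rule ext_integral_eq_PInf) (use that fin in auto)
  show ?thesis
    unfolding F
    by (cases "integrable N (\<lambda>x. ln (w x))"; cases "integrable N (\<lambda>x. ln (f x))")
       (auto simp: w f ext_integral_integrable)
qed

lemma Gibbs:
  assumes int: "integrable N (\<lambda>x. ln (w x))" "integrable N (\<lambda>x. ln (f x))"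
  shows "- ln Z \<le> (LINT x|N. ln (f x) - ln (w x))"
    and "(LINT x|N. ln (f x) - ln (w x)) = - ln Z \<longleftrightarrow> N = posterior"
proof -
  interpret N: prob_space N by (rule prob_N)
  interpret P: prob_space posterior by (rule prob_space_posterior)
  \<comment> \<open>Base \<open>exp 1\<close> makes the logarithm in \<open>KL_divergence\<close>
    the natural one.\<close>
  interpret P: information_space posterior "exp 1"
    by unfold_locales simp
  \<comment> \<open>The density of \<open>N\<close> with respect to \<open>posterior\<close>, as the
    quotient of their densities with respect to \<open>M\<close>.\<close>
  define D where "D x = f x / (w x / Z)" for x
  have [measurable]: "D \<in> borel_measurable M"
    unfolding D_def by measurable
  have D_nonneg: "AE x in posterior. 0 \<le> D x"
    unfolding D_def
    by (rule absolutely_continuous_AE[OF sets_posterior absolutely_continuous_posterior])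
       (use AE_w_div_Z in \<open>eventually_elim, intro divide_nonneg_pos f_nonneg\<close>)
  have N_D: "N = density posterior (\<lambda>x. ennreal (D x))"
  proof -
    have "density posterior (\<lambda>x. ennreal (D x)) = density M (\<lambda>x. ennreal (w x / Z) * ennreal (D x))"
      unfolding posterior_def by (rule density_density_eq) auto
    also have "\<dots> = density M (\<lambda>x. ennreal (f x))"
    proof (rule density_cong)
      show "AE x in M. ennreal (w x / Z) * ennreal (D x) = ennreal (f x)"
        using AE_w_div_Z
      proof eventually_elim
        case (elim x)
        then have "w x / Z * D x = f x" "w x / Z \<ge> 0" by (auto simp: D_def)
        then show ?case by (metis ennreal_mult')
      qed
    qed auto
    finally show ?thesis by (rule trans[OF N_eq sym])
  qed
  \<comment> \<open>The constant \<open>ln Z\<close> splits off; as \<open>N\<close> has mass one,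
    it is exactly the gap between the divergence from \<open>posterior\<close> and the free
    energy.\<close>
  have ln_D: "AE x in N. ln (D x) = ln (f x) - ln (w x) + ln Z"
    using AE_N by eventually_elim (use Z_pos in \<open>simp add: D_def ln_div ln_mult\<close>)
  have int_D: "integrable N (\<lambda>x. ln (D x))"
    by (subst integrable_cong_AE[OF _ _ ln_D]) (use int in auto)
  have "(LINT x|N. ln (D x)) = (LINT x|N. ln (f x) - ln (w x) + ln Z)"
    by (rule integral_cong_AE[OF _ _ ln_D]) auto
  also have "\<dots> = (LINT x|N. ln (f x) - ln (w x)) + ln Z"
    using int by (simp add: N.prob_space)
  finally have eq: "(LINT x|N. ln (D x)) = (LINT x|N. ln (f x) - ln (w x)) + ln Z" .
  \<comment> \<open>The divergence is the integral of \<open>D ln D\<close> against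
    \<open>posterior\<close>; the factor \<open>D\<close> is absorbed by changing the measure to
    \<open>N\<close>.\<close>
  have KL: "KL_divergence (exp 1) posterior N = (LINT x|N. ln (D x))"
  proof -
    have "KL_divergence (exp 1) posterior N = (LINT x|posterior. D x * log (exp 1) (D x))"
      by (subst N_D, rule P.KL_density) (auto simp: D_nonneg)
    also have "\<dots> = (LINT x|N. ln (D x))"
      by (subst N_D, subst integral_density) (auto simp: D_nonneg log_def)
    finally show ?thesis .
  qed
  have prob: "prob_space (density posterior (\<lambda>x. ennreal (D x)))"
    using prob_N N_D by simp
  have int': "integrable posterior (\<lambda>x. D x * log (exp 1) (D x))"
    using int_D by (subst (asm) N_D, subst (asm) integrable_density) (auto simp: D_nonneg log_def)
  have "0 \<le> KL_divergence (exp 1) posterior N"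
    using P.KL_nonneg[OF prob _ D_nonneg int'] N_D by simp
  with KL eq show "- ln Z \<le> (LINT x|N. ln (f x) - ln (w x))" by simp
  have "KL_divergence (exp 1) posterior N = 0 \<longleftrightarrow> N = posterior"
    using P.KL_eq_0_iff_eq[OF prob _ D_nonneg int'] N_D by simp
  with KL eq show "(LINT x|N. ln (f x) - ln (w x)) = - ln Z \<longleftrightarrow> N = posterior" by auto
qed

lemma free_energy_ge: "ereal (- ln Z) \<le> free_energy M w N"
  and free_energy_eq_imp: "free_energy M w N = ereal (- ln Z) \<Longrightarrow> N = posterior"
proof -
  \<comment> \<open>An infinite free energy satisfies the bound and differs from the real number
    \<open>- ln Z\<close>; the finite case is Gibbs' inequality.\<close>
  consider "free_energy M w N = \<infinity>"
    | "integrable N (\<lambda>x. ln (w x))" "integrable N (\<lambda>x. ln (f x))"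
      "free_energy M w N = ereal (LINT x|N. ln (f x) - ln (w x))"
    using free_energy_eq by metis
  then have "ereal (- ln Z) \<le> free_energy M w N \<and>
      (free_energy M w N = ereal (- ln Z) \<longrightarrow> N = posterior)"
  proof cases
    case 2
    show ?thesis
      unfolding 2(3) ereal_less_eq(3) ereal.inject using Gibbs[OF 2(1,2)] by blast
  qed simp
  then show "ereal (- ln Z) \<le> free_energy M w N"
    and "free_energy M w N = ereal (- ln Z) \<Longrightarrow> N = posterior" by auto
qed

end

section \<open>The posterior as the unique minimizer\<close>

context weighted_prior
begin

lemma free_energy_posterior: "free_energy M w posterior = ereal (- ln Z)"
proof -
  interpret P: prob_space posterior by (rule prob_space_posterior)
  \<comment> \<open>The posterior is taken as its own competitor.\<close>
  interpret P: weighted_prior_ac M w posterior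
    by unfold_locales (auto simp: absolutely_continuous_posterior P.prob_space_axioms)
  have int_w: "integrable posterior (\<lambda>x. ln (w x))"
  proof -
    \<comment> \<open>\<open>ln w\<close> may be unbounded, but weighted by the density it is not:
      \<open>w ln w\<close> is at most 1 in absolute value for \<open>w\<close> in (0,1].\<close>
    have bound: "AE x in M. norm (w x / Z * ln (w x)) \<le> 1 / Z"
      using AE_w
    proof eventually_elim
      case (elim x)
      then have "\<bar>w x * ln (w x)\<bar> \<le> 1"
        using neg_mult_ln_le_one[of "w x"] mult_nonneg_nonpos[of "w x" "ln (w x)"]
        by (simp add: abs_le_iff)
      then show ?case using Z_pos by (simp add: abs_mult divide_right_mono)
    qed
    have "integrable M (\<lambda>x. w x / Z * ln (w x))"
      by (rule integrable_const_bound[OF bound]) simp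
    moreover have "AE x in M. 0 \<le> w x / Z"
      using AE_w_div_Z by eventually_elim simp
    ultimately show ?thesis
      unfolding posterior_def by (subst integrable_density) auto
  qed
  \<comment> \<open>Uniqueness of the derivative identifies \<open>P.f\<close> with
    \<open>w / Z\<close>, so integrability of \<open>ln w\<close> carries over to
    \<open>ln (P.f)\<close>.\<close>
  have "AE x in M. ennreal (w x / Z) = RN_deriv M posterior x"
    by (rule RN_deriv_unique) (auto simp: posterior_def)
  then have "AE x in M. P.f x = w x / Z"
    using AE_w_div_Z by eventually_elim (auto simp: P.f_def dest: sym)
  then have "AE x in posterior. P.f x = w x / Z"
    by (rule absolutely_continuous_AE[OF sets_posterior absolutely_continuous_posterior])
  then have ln_f: "AE x in posterior. ln (P.f x) = ln (w x) - ln Z"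
    using P.AE_N by eventually_elim (use Z_pos in \<open>simp add: ln_div\<close>)
  have "integrable posterior (\<lambda>x. ln (P.f x))"
    by (subst integrable_cong_AE[OF _ _ ln_f]) (use int_w in auto)
  \<comment> \<open>The value comes from the equality case of \<open>Gibbs\<close> with
    \<open>N = posterior\<close>, without evaluating the integral.\<close>
  then show ?thesis
    using P.Gibbs(2) int_w by (simp add: P.free_energy_eq)
qed

lemma free_energy_lower_bound:
  assumes "N \<in> prob_measures M"
  shows "ereal (- ln Z) \<le> free_energy M w N"
    and "free_energy M w N = ereal (- ln Z) \<Longrightarrow> N = posterior"
proof -
  consider "\<not> absolutely_continuous M N" | "weighted_prior_ac M w N"
    using assms weighted_prior_axioms
    by (auto simp: prob_measures_def weighted_prior_ac_def weighted_prior_ac_axioms_def)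
  then have "ereal (- ln Z) \<le> free_energy M w N \<and>
      (free_energy M w N = ereal (- ln Z) \<longrightarrow> N = posterior)"
  proof cases
    case 1
    then show ?thesis by (simp add: free_energy_def)
  next
    case 2
    then show ?thesis
      using weighted_prior_ac.free_energy_ge weighted_prior_ac.free_energy_eq_imp by blast
  qed
  then show "ereal (- ln Z) \<le> free_energy M w N"
    and "free_energy M w N = ereal (- ln Z) \<Longrightarrow> N = posterior" by auto
qed

lemma posterior_in_prob_measures: "posterior \<in> prob_measures M"
  by (simp add: prob_measures_def prob_space_posterior)

text \<open>The free energy of \<open>posterior\<close> is the lower bound itself, so any other
  minimizer would attain that bound too, which only \<open>posterior\<close> does.\<close>

lemma is_arg_min_free_energy_iff:
  "is_arg_min (free_energy M w) (\<lambda>N. N \<in> prob_measures M) N \<longleftrightarrow> N = posterior"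
proof
  assume "N = posterior"
  then show "is_arg_min (free_energy M w) (\<lambda>N. N \<in> prob_measures M) N"
    using free_energy_lower_bound(1) posterior_in_prob_measures
    by (simp add: is_arg_min_linorder free_energy_posterior)
next
  assume N: "is_arg_min (free_energy M w) (\<lambda>N. N \<in> prob_measures M) N"
  then have "N \<in> prob_measures M" "free_energy M w N \<le> free_energy M w posterior"
    using posterior_in_prob_measures by (auto simp: is_arg_min_linorder)
  then show "N = posterior"
    by (intro free_energy_lower_bound(2) antisym free_energy_lower_bound(1))
       (auto simp: free_energy_posterior)
qed

lemma INF_free_energy:
  "(INF N\<in>prob_measures M. free_energy M w N) = free_energy M w posterior"
proof (rule antisym)
  show "(INF N\<in>prob_measures M. free_energy M w N) \<le> free_energy M w posterior"
    by (rule INF_lower[OF posterior_in_prob_measures])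
  show "free_energy M w posterior \<le> (INF N\<in>prob_measures M. free_energy M w N)"
    unfolding free_energy_posterior by (rule INF_greatest[OF free_energy_lower_bound(1)])
qed

end

theorem proposition4p1:
  fixes \<Theta> :: "(real ^ 'm) set"
    and d :: "real ^ 'm \<Rightarrow> real ^ 'm \<Rightarrow> real"
    and \<pi> :: "(real ^ 'm) measure"
    and w :: "real \<Rightarrow> real ^ 'm \<Rightarrow> real"
    and \<epsilon> :: real
  assumes "Metric_space \<Theta> d"
    and "\<pi> \<in> prob_measures (metric_borel \<Theta> d)"
    and "\<epsilon> > 0"
    and "w \<epsilon> \<in> borel_measurable (metric_borel \<Theta> d)"
    and "\<forall>\<theta>\<in>\<Theta>. 0 \<le> w \<epsilon> \<theta>"
    and "AE \<theta> in \<pi>. 0 < w \<epsilon> \<theta> \<and> w \<epsilon> \<theta> \<le> 1"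
  shows "weighted_posterior \<pi> (w \<epsilon>) \<in> prob_measures (metric_borel \<Theta> d)
    \<and> (\<forall>B \<in> sets (metric_borel \<Theta> d).
           measure (weighted_posterior \<pi> (w \<epsilon>)) B =
             (LINT \<theta>:B|\<pi>. w \<epsilon> \<theta>) / (LINT \<theta>|\<pi>. w \<epsilon> \<theta>))
    \<and> (\<forall>\<rho>. is_arg_min (free_energy \<pi> (w \<epsilon>)) (\<lambda>\<rho>. \<rho> \<in> prob_measures (metric_borel \<Theta> d)) \<rho>
           \<longleftrightarrow> \<rho> = weighted_posterior \<pi> (w \<epsilon>))
    \<and> ((INF \<rho>\<in>prob_measures (metric_borel \<Theta> d). free_energy \<pi> (w \<epsilon>) \<rho>) =
           free_energy \<pi> (w \<epsilon>) (weighted_posterior \<pi> (w \<epsilon>)))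
    \<and> (free_energy \<pi> (w \<epsilon>) (weighted_posterior \<pi> (w \<epsilon>)) =
           ereal (- ln (LINT \<theta>|\<pi>. w \<epsilon> \<theta>)))"
proof -
  let ?S = "metric_borel \<Theta> d"
  have sets: "sets \<pi> = sets ?S" and prob: "prob_space \<pi>"
    using assms(2) by (auto simp: prob_measures_def)
  interpret weighted_prior \<pi> "w \<epsilon>"
    using assms(4,6) prob
    by (auto simp: weighted_prior_def weighted_prior_axioms_def measurable_cong_sets[OF sets refl])
  \<comment> \<open>\<open>prob_measures\<close> sees only the sigma-algebra of its argument, which
    \<open>\<pi>\<close> shares with the Borel space.\<close>
  have S: "prob_measures ?S = prob_measures \<pi>"
    by (simp add: prob_measures_def sets)
  show ?thesis
    unfolding S weighted_posterior_eq sets[symmetric]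
    by (intro conjI ballI allI posterior_in_prob_measures measure_posterior
        is_arg_min_free_energy_iff INF_free_energy free_energy_posterior)
qed

end
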